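(* Let $a,d$ be integers with $0<a<d$. For every prime $p>d$: $p\equiv a\pmod d$ if and only if, in $\mathbb{Z}_p$, $(d-a)/d$ is the smallest fraction of the set $\{1/d,2/d,\ldots,(d-1)/d\}$.
   Context: For a prime $p$ and positive integers $b,d$ not divisible by $p$, the fraction $b/d$ in $\mathbb{Z}_p$ denotes the unique integer $r$ with $0<r<p$ such that $r\cdot d\equiv b\pmod p$; fractions are compared as these integers. *)

theory Defs
  imports "HOL-Number_Theory.Cong"
begin

text \<open>The fraction \<open>b/d\<close> in \<open>\<int>\<^sub>p\<close>, as an integer representative. It is meaningful only
  when \<open>p\<close> is prime and divides neither \<open>b\<close> nor \<open>d\<close>; see \<open>zp_frac_ex1\<close>.\<close>

definition zp_frac :: "int \<Rightarrow> int \<Rightarrow> int \<Rightarrow> int" where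
  "zp_frac p b d = (THE r. 0 < r \<and> r < p \<and> [r * d = b] (mod p))"

lemma zp_frac_ex1:
  fixes p b d :: int
  assumes "prime p" and "\<not> p dvd b" and "\<not> p dvd d"
  shows "\<exists>!r. 0 < r \<and> r < p \<and> [r * d = b] (mod p)"
proof -
  have p: "p > 0" using assms(1) by (simp add: prime_gt_0_int)
  have cop: "coprime d p"
    using prime_imp_coprime[OF assms(1,3)] by (simp add: coprime_commute)
  obtain x where x: "[d * x = 1] (mod p)"
    using cop cong_solve_coprime_int by blast
  define r where "r = (b * x) mod p"
  have "[r * d = (b * x) * d] (mod p)"
    unfolding r_def by (intro cong_mult) (auto simp: cong_def)
  moreover have "[b * (d * x) = b * 1] (mod p)"
    using x by (intro cong_mult) auto
  ultimately have r: "[r * d = b] (mod p)"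
    by (simp add: mult_ac cong_def)
  have "r \<noteq> 0"
  proof
    assume "r = 0"
    then have "[b = 0] (mod p)" using r by (simp add: cong_sym)
    then show False using assms(2) by (simp add: cong_0_iff)
  qed
  moreover have "0 \<le> r" "r < p" using p by (simp_all add: r_def)
  ultimately have ex: "0 < r \<and> r < p \<and> [r * d = b] (mod p)" using r by simp
  show ?thesis
  proof (rule ex1I[of _ r])
    show "0 < r \<and> r < p \<and> [r * d = b] (mod p)" by (fact ex)
  next
    fix s assume s: "0 < s \<and> s < p \<and> [s * d = b] (mod p)"
    have "[s * d = r * d] (mod p)" using s r cong_sym cong_trans by blast
    then have "[s = r] (mod p)" using cop by (simp add: cong_mult_rcancel)
    then show "s = r" using s ex cong_less_imp_eq_int by (meson less_imp_le)
  qed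
qed

end

theory Submission
  imports Defs
begin

text \<open>Write \<open>r = k/d\<close> as \<open>r * d = k + m * p\<close>; here \<open>m > 0\<close> because \<open>d\<close> does not divide \<open>k\<close>.
  Since \<open>0 < k < p\<close>, the fractions with \<open>m = 1\<close> lie below \<open>2 * p / d\<close> and all others above it.
  The case \<open>m = 1\<close> occurs exactly when \<open>d\<close> divides \<open>k + p\<close>, which holds for a single \<open>k\<close>
  between \<open>1\<close> and \<open>d - 1\<close>.\<close>

lemma zp_frac_less_iff:
  fixes p k d :: int
  assumes "prime p" "d < p" "0 < k" "k < d"
  shows "zp_frac p k d * d < 2 * p \<longleftrightarrow> d dvd k + p"
proof -
  have ex1: "\<exists>!r. 0 < r \<and> r < p \<and> [r * d = k] (mod p)"
    using assms by (intro zp_frac_ex1) (auto dest: zdvd_imp_le)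
  define r where "r = zp_frac p k d"
  have r: "0 < r" "r < p" "[r * d = k] (mod p)"
    using theI'[OF ex1] by (simp_all add: r_def zp_frac_def)
  have "r * d < 2 * p \<longleftrightarrow> d dvd k + p"
  proof
    assume less: "r * d < 2 * p"
    obtain m where m: "r * d = k + m * p"
      using r(3) by (metis cong_iff_lin cong_sym mult.commute)
    have "m * p < 2 * p" using less m assms by linarith
    then have "m < 2" using assms by simp
    moreover have "m > - 1"
    proof -
      have "0 < r * d" using r assms by simp
      \<comment> \<open>Positivity of \<open>r * d = k + m * p\<close> together with
        \<open>k < d < p\<close> forces \<open>m * p > - p\<close>.\<close>
      then have "(- 1) * p < m * p" using m assms by linarith
      then show ?thesis using assms mult_less_cancel_right_pos[of p "- 1" m] by linarith
    qed
    \<comment> \<open>With \<open>m = 0\<close>, \<open>d\<close> would divide \<open>k\<close>,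
      although \<open>0 < k < d\<close>.\<close>
    moreover have "m \<noteq> 0"
      using m assms zdvd_not_zless[of k d] by (metis add.right_neutral dvd_triv_right mult_zero_left)
    ultimately have "m = 1" by linarith
    then show "d dvd k + p" using m by (metis dvd_triv_right mult_1)
  next
    assume "d dvd k + p"
    then obtain q where q: "k + p = q * d" by (metis dvd_def mult.commute)
    have "0 < q * d" using q assms by linarith
    then have "0 < q" using assms by (simp add: zero_less_mult_iff)
    \<comment> \<open>This makes \<open>q\<close> an admissible representative, so uniqueness
      identifies it with \<open>r\<close>. The bound comes from \<open>k + p < 2 * p\<close> and
      \<open>d \<ge> 2\<close>.\<close>
    moreover have "q < p"
    proof -
      have "2 * p \<le> d * p" using assms by (intro mult_right_mono) auto
      then have "q * d < p * d" using q assms mult.commute[of d p] by linarith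
      then show ?thesis using assms by simp
    qed
    moreover have "[q * d = k] (mod p)" by (simp flip: q add: cong_def)
    ultimately have "r = q" using ex1 r by blast
    then show "r * d < 2 * p" using q assms by simp
  qed
  then show ?thesis by (simp add: r_def)
qed

theorem theorem5p17:
  fixes a d p :: int
  assumes "0 < a" and "a < d" and "prime p" and "p > d"
  shows "[p = a] (mod d) \<longleftrightarrow>
    zp_frac p (d - a) d = Min ((\<lambda>k. zp_frac p k d) ` {1..d - 1})"
proof -
  let ?f = "\<lambda>k. zp_frac p k d"
  have small: "?f k * d < 2 * p \<longleftrightarrow> d dvd k + p" if "k \<in> {1..d - 1}" for k
    using that assms by (intro zp_frac_less_iff) auto
  have a: "d - a \<in> {1..d - 1}" using assms by simp
  have "[p = a] (mod d) \<longleftrightarrow> d dvd (d - a + p) - d"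
    by (simp add: cong_iff_dvd_diff)
  also have "\<dots> \<longleftrightarrow> d dvd d - a + p"
    by (simp only: dvd_diff_left_iff dvd_refl)
  finally have cong: "[p = a] (mod d) \<longleftrightarrow> d dvd d - a + p" .
  show ?thesis
  proof
    assume "[p = a] (mod d)"
    then have dvd: "d dvd d - a + p" using cong by simp
    have "?f (d - a) \<le> ?f k" if k: "k \<in> {1..d - 1}" for k
    proof (cases "d dvd k + p")
      case True
      then have "[k = d - a] (mod d)"
        using dvd_diff[OF True dvd] by (simp add: cong_iff_dvd_diff)
      then have "k = d - a"
        using k a by (intro cong_less_imp_eq_int[of k d]) auto
      then show ?thesis by simp
    next
      case False
      \<comment> \<open>The threshold \<open>2 * p\<close> separates the two products: the left one
        lies below it, the right one does not.\<close>
      then have "?f (d - a) * d < ?f k * d"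
        using small[OF k] small[OF a] dvd by linarith
      then show ?thesis using assms by simp
    qed
    then show "?f (d - a) = Min (?f ` {1..d - 1})"
      using a by (intro Min_eqI[symmetric]) auto
  next
    assume min: "?f (d - a) = Min (?f ` {1..d - 1})"
    \<comment> \<open>The one index whose fraction lies below the threshold. It is nonzero because
      the prime \<open>p\<close> has no divisor \<open>d\<close> with
      \<open>1 < d < p\<close>.\<close>
    define k where "k = (- p) mod d"
    have "\<not> d dvd p"
    proof
      assume "d dvd p"
      moreover have "0 \<le> d" using assms by linarith
      ultimately have "d = 1 \<or> d = p" using \<open>prime p\<close> unfolding prime_int_iff by blast
      then show False using assms by linarith
    qed
    then have "k \<noteq> 0" by (metis k_def dvd_eq_mod_eq_0 dvd_minus_iff)
    moreover have "0 \<le> k" "k < d" using assms by (simp_all add: k_def)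
    ultimately have k: "k \<in> {1..d - 1}" by simp
    have "d dvd k + p"
      by (simp add: k_def dvd_eq_mod_eq_0 mod_simps)
    moreover have "?f (d - a) \<le> ?f k" using k by (simp add: min)
    then have "?f (d - a) * d \<le> ?f k * d" using assms by simp
    \<comment> \<open>Minimality passes the bound from \<open>k\<close> to \<open>d - a\<close>, and
      the criterion turns it back into divisibility.\<close>
    ultimately have "?f (d - a) * d < 2 * p" using small[OF k] by linarith
    then show "[p = a] (mod d)" using small[OF a] cong by simp
  qed
qed

end
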